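(* Let $n\geq 2$, let $\Omega\subset\mathbb{C}^n$ be a bounded domain, and let $K\subset\Omega$ be a compact subset such that $\Omega\setminus K$ is again a domain. Then every holomorphic function $f\colon\Omega\setminus K\to\mathbb{C}$ has a unique holomorphic extension to $\Omega$; that is, there is exactly one holomorphic function $\tilde{f}\colon\Omega\to\mathbb{C}$ with $\tilde{f}|_{\Omega\setminus K}=f$.
   Context: A domain in $\mathbb{C}^n$ is an open and path-connected subset. A function $f\colon U\to\mathbb{C}$ on an open set $U\subseteq\mathbb{C}^n$ is holomorphic if it is continuous and holomorphic in each variable separately (when the other variables are held fixed). *)

theory Defs
  imports "HOL-Complex_Analysis.Complex_Analysis" "HOL-Library.FuncSet"
begin

definition domain_Cn :: "(complex ^ 'n) set \<Rightarrow> bool" where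
  "domain_Cn U \<longleftrightarrow> open U \<and> path_connected U"

definition subst_coord :: "complex ^ 'n \<Rightarrow> 'n \<Rightarrow> complex \<Rightarrow> complex ^ 'n" where
  "subst_coord z i w = (\<chi> j. if j = i then w else z $ j)"

text \<open>Intended for open \<open>U\<close>; the one-variable slices of \<open>U\<close> are then open subsets of the
  complex plane. The predicate depends only on the values of \<open>f\<close> on \<open>U\<close>.\<close>

definition holomorphic_Cn_on :: "(complex ^ 'n \<Rightarrow> complex) \<Rightarrow> (complex ^ 'n) set \<Rightarrow> bool"
    (infixl "holomorphic'_Cn'_on" 50) where
  "f holomorphic_Cn_on U \<longleftrightarrow>
     continuous_on U f \<and>
     (\<forall>z\<in>U. \<forall>i. (\<lambda>w. f (subst_coord z i w)) holomorphic_on {w. subst_coord z i w \<in> U})"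

end

theory Submission imports Defs begin

text \<open>
  The extension is given by an explicit Cauchy integral. Let \<open>i \<noteq> j\<close> be two coordinates and, for
  \<open>z \<in> \<Omega>\<close>, consider the slices of \<open>\<Omega>\<close> and \<open>K\<close> by the complex line through \<open>z\<close> in direction \<open>i\<close>. The
  classical formula would integrate \<open>f w / (w - z $ i)\<close>, with \<open>f w\<close> short for the value of \<open>f\<close> at \<open>z\<close>
  with coordinate \<open>i\<close> replaced by \<open>w\<close>, over a cycle in the slice of \<open>\<Omega> - K\<close> that
  winds once around the slice of \<open>K\<close> and around \<open>z $ i\<close>. Here the cycle is replaced by a
  continuously differentiable cutoff function \<open>\<phi>\<close> with compact support in the slice of \<open>\<Omega>\<close> that is
  1 near the slice of \<open>K\<close> and near \<open>z $ i\<close>: the extension at \<open>z\<close> is \<open>-1 / (2 * pi)\<close> times the area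
  integral of \<open>dbar \<phi> w * f w / (w - z $ i)\<close>.

  By Green's formula the integral does not depend on \<open>\<phi>\<close> (\<open>hartogs_integral_cutoff_indep\<close>). By
  compactness, one \<open>\<phi>\<close> serves for all \<open>z\<close> near a given point, so the integral is holomorphic on all of
  \<open>\<Omega>\<close> (\<open>hartogs_extension_holomorphic\<close>). It equals \<open>f z\<close> if the slice of \<open>K\<close> through \<open>z\<close> is empty
  (\<open>hartogs_extension_eq_f\<close>), and such points contain a nonempty open subset of \<open>\<Omega> - K\<close>, namely the
  points of \<open>\<Omega>\<close> at which \<open>Re (z $ j)\<close> exceeds its maximum on \<open>K\<close> (\<open>exists_open_missing_slices\<close>).
  As \<open>\<Omega> - K\<close> is connected, the identity theorem (\<open>holomorphic_Cn_identity\<close>) gives equality on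
  \<open>\<Omega> - K\<close>; the same theorem on the connected set \<open>\<Omega>\<close> gives uniqueness.
\<close>

section \<open>The operator dbar on continuously differentiable functions\<close>

text \<open>Continuous differentiability in the real sense. The two partial derivatives of \<open>g\<close> at \<open>w\<close>
  are the values of the Frechet derivative at \<open>1\<close> and at \<open>\<i>\<close>.\<close>

definition C1_on :: "complex set \<Rightarrow> (complex \<Rightarrow> complex) \<Rightarrow> bool" where
  "C1_on U g \<longleftrightarrow> (\<forall>w\<in>U. g differentiable at w) \<and>
     continuous_on U (\<lambda>w. frechet_derivative g (at w) 1) \<and>
     continuous_on U (\<lambda>w. frechet_derivative g (at w) \<i>)"

text \<open>The operator \<open>d/dx + \<i> d/dy\<close>, that is, twice the Wirtinger derivative with respect to the
  conjugate variable.\<close>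

definition dbar :: "(complex \<Rightarrow> complex) \<Rightarrow> complex \<Rightarrow> complex" where
  "dbar g w = frechet_derivative g (at w) 1 + \<i> * frechet_derivative g (at w) \<i>"

lemma C1_onI:
  assumes "\<And>w. w \<in> U \<Longrightarrow> (g has_derivative G w) (at w)"
    and "continuous_on U (\<lambda>w. G w 1)" "continuous_on U (\<lambda>w. G w \<i>)"
  shows "C1_on U g"
proof -
  have "frechet_derivative g (at w) = G w" if "w \<in> U" for w
    using frechet_derivative_at[OF assms(1)[OF that]] by simp
  with assms show ?thesis
    unfolding C1_on_def differentiable_def by (auto cong: continuous_on_cong)
qed

lemma dbar_eq:
  assumes "(g has_derivative G) (at w)"
  shows "dbar g w = G 1 + \<i> * G \<i>"
  using frechet_derivative_at[OF assms] by (simp add: dbar_def)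

lemma C1_on_has_derivative:
  "C1_on U g \<Longrightarrow> w \<in> U \<Longrightarrow> (g has_derivative frechet_derivative g (at w)) (at w)"
  by (simp add: C1_on_def frechet_derivative_works)

lemma C1_on_imp_continuous_on: "C1_on U g \<Longrightarrow> continuous_on U g"
  by (metis C1_on_def continuous_at_imp_continuous_on differentiable_imp_continuous_within)

lemma continuous_on_dbar: "C1_on U g \<Longrightarrow> continuous_on U (dbar g)"
  unfolding C1_on_def dbar_def[abs_def] by (auto intro!: continuous_intros)

lemma C1_on_subset: "C1_on U g \<Longrightarrow> V \<subseteq> U \<Longrightarrow> C1_on V g"
  unfolding C1_on_def by (meson continuous_on_subset subsetD)

lemma C1_on_Un:
  assumes "open U" "open V" "C1_on U g" "C1_on V g"
  shows "C1_on (U \<union> V) g"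
  using assms unfolding C1_on_def by (auto intro!: continuous_on_open_Un)

lemma has_derivative_cong_open:
  assumes "open U" "w \<in> U" "\<And>x. x \<in> U \<Longrightarrow> f x = g x"
  shows "(f has_derivative G) (at w) \<longleftrightarrow> (g has_derivative G) (at w)"
  using assms by (metis has_derivative_transform_within_open)

lemma C1_on_cong:
  assumes "open U" "\<And>x. x \<in> U \<Longrightarrow> f x = g x" "C1_on U f"
  shows "C1_on U g"
proof (rule C1_onI)
  show "(g has_derivative frechet_derivative f (at w)) (at w)" if "w \<in> U" for w
    using C1_on_has_derivative[OF assms(3) that] has_derivative_cong_open[OF assms(1) that assms(2)]
    by simp
qed (use assms(3) in \<open>auto simp: C1_on_def\<close>)

lemma dbar_cong:
  assumes "open U" "w \<in> U" "\<And>x. x \<in> U \<Longrightarrow> f x = g x"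
  shows "dbar f w = dbar g w"
  using has_derivative_cong_open[of U w f g] assms
  unfolding dbar_def frechet_derivative_def by simp

lemma dbar_const [simp]: "dbar (\<lambda>w. c) w = 0"
  by (simp add: dbar_eq[OF has_derivative_const])

lemma C1_on_const: "C1_on U (\<lambda>w. c)"
  by (rule C1_onI[OF has_derivative_const]) auto

lemma C1_on_mult:
  assumes "C1_on U f" "C1_on U g"
  shows "C1_on U (\<lambda>w. f w * g w)"
proof (rule C1_onI)
  show "((\<lambda>w. f w * g w) has_derivative
    (\<lambda>h. f w * frechet_derivative g (at w) h + frechet_derivative f (at w) h * g w)) (at w)"
    if "w \<in> U" for w
    by (intro has_derivative_mult C1_on_has_derivative[OF _ that] assms)
next
  note c = assms[THEN C1_on_imp_continuous_on] assms[unfolded C1_on_def]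
  show "continuous_on U (\<lambda>w. f w * frechet_derivative g (at w) 1 + frechet_derivative f (at w) 1 * g w)"
    "continuous_on U (\<lambda>w. f w * frechet_derivative g (at w) \<i> + frechet_derivative f (at w) \<i> * g w)"
    using c by (auto intro!: continuous_on_add continuous_on_mult)
qed

lemma dbar_mult:
  assumes "C1_on U f" "C1_on U g" "w \<in> U"
  shows "dbar (\<lambda>w. f w * g w) w = dbar f w * g w + f w * dbar g w"
  by (subst dbar_eq[OF has_derivative_mult[OF assms(1,2)[THEN C1_on_has_derivative[OF _ assms(3)]]]])
    (simp add: dbar_def algebra_simps)

lemma C1_on_diff:
  assumes "C1_on U f" "C1_on U g"
  shows "C1_on U (\<lambda>w. f w - g w)"
proof (rule C1_onI)
  show "((\<lambda>w. f w - g w) has_derivative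
    (\<lambda>h. frechet_derivative f (at w) h - frechet_derivative g (at w) h)) (at w)"
    if "w \<in> U" for w
    by (intro has_derivative_diff C1_on_has_derivative[OF _ that] assms)
next
  show "continuous_on U (\<lambda>w. frechet_derivative f (at w) 1 - frechet_derivative g (at w) 1)"
    "continuous_on U (\<lambda>w. frechet_derivative f (at w) \<i> - frechet_derivative g (at w) \<i>)"
    using assms[unfolded C1_on_def] by (auto intro!: continuous_on_diff)
qed

lemma dbar_diff:
  assumes "C1_on U f" "C1_on U g" "w \<in> U"
  shows "dbar (\<lambda>w. f w - g w) w = dbar f w - dbar g w"
  by (subst dbar_eq[OF has_derivative_diff[OF assms(1,2)[THEN C1_on_has_derivative[OF _ assms(3)]]]])
    (simp add: dbar_def algebra_simps)

lemma holomorphic_has_derivative: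
  assumes "h holomorphic_on U" "open U" "w \<in> U"
  shows "(h has_derivative (*) (deriv h w)) (at w)"
  using holomorphic_derivI[OF assms] by (simp add: has_field_derivative_def)

lemma holomorphic_imp_C1_on:
  assumes "h holomorphic_on U" "open U"
  shows "C1_on U h"
proof (rule C1_onI[OF holomorphic_has_derivative[OF assms]])
  have "continuous_on U (deriv h)"
    using assms by (simp add: holomorphic_deriv holomorphic_on_imp_continuous_on)
  then show "continuous_on U (\<lambda>w. deriv h w * 1)" "continuous_on U (\<lambda>w. deriv h w * \<i>)"
    by (auto intro!: continuous_intros)
qed

lemma dbar_holomorphic:
  assumes "h holomorphic_on U" "open U" "w \<in> U"
  shows "dbar h w = 0"
  by (subst dbar_eq[OF holomorphic_has_derivative[OF assms]]) (simp add: algebra_simps)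

section \<open>Integrals over squares and the formulas of Green and Cauchy\<close>

text \<open>The area integral over the closed square with centre 0 and side \<open>2 * R\<close>.\<close>

definition area_integral :: "real \<Rightarrow> (complex \<Rightarrow> complex) \<Rightarrow> complex" where
  "area_integral R h = integral (cbox (-R, -R) (R, R)) (\<lambda>(x, y). h (Complex x y))"

lemma area_integral_iterated:
  assumes "continuous_on UNIV h"
  shows "area_integral R h = integral {-R..R} (\<lambda>x. integral {-R..R} (\<lambda>y. h (Complex x y)))"
    and "area_integral R h = integral {-R..R} (\<lambda>y. integral {-R..R} (\<lambda>x. h (Complex x y)))"
proof -
  have c: "continuous_on (cbox (-R, -R) (R, R)) (\<lambda>(x, y). h (Complex x y))"
    unfolding case_prod_unfold
    by (intro continuous_on_compose2[OF assms] continuous_intros) auto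
  show 1: "area_integral R h = integral {-R..R} (\<lambda>x. integral {-R..R} (\<lambda>y. h (Complex x y)))"
    unfolding area_integral_def using integral_prod_continuous[OF c] by simp
  show "area_integral R h = integral {-R..R} (\<lambda>y. integral {-R..R} (\<lambda>x. h (Complex x y)))"
    using 1 integral_swap_continuous[OF c] by simp
qed

lemma area_integral_integrable:
  fixes h :: "complex \<Rightarrow> complex"
  assumes "continuous_on UNIV h"
  shows "(\<lambda>(x, y). h (Complex x y)) integrable_on cbox (-R, -R) (R, R)"
proof (rule integrable_continuous)
  show "continuous_on (cbox (- R, - R) (R, R)) (\<lambda>(x, y). h (Complex x y))"
    unfolding case_prod_unfold
    by (intro continuous_on_compose2[OF assms] continuous_intros) auto
qed

lemma area_integral_add:
  assumes "continuous_on UNIV g" "continuous_on UNIV h"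
  shows "area_integral R (\<lambda>w. g w + h w) = area_integral R g + area_integral R h"
  using integral_add[OF assms[THEN area_integral_integrable]]
  unfolding area_integral_def by (simp add: case_prod_unfold)

lemma area_integral_diff:
  assumes "continuous_on UNIV g" "continuous_on UNIV h"
  shows "area_integral R (\<lambda>w. g w - h w) = area_integral R g - area_integral R h"
  using integral_diff[OF assms[THEN area_integral_integrable]]
  unfolding area_integral_def by (simp add: case_prod_unfold)

lemma area_integral_mult_left: "area_integral R (\<lambda>w. c * h w) = c * area_integral R h"
  unfolding area_integral_def by (simp add: case_prod_unfold)

text \<open>Green's formula for a square: the fundamental theorem of calculus in each variable, after
  Fubini.\<close>

lemma green_box:
  assumes g: "C1_on UNIV g" and R: "R > 0"
  shows "area_integral R (dbar g) =
    integral {-R..R} (\<lambda>y. g (Complex R y) - g (Complex (-R) y)) +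
    \<i> * integral {-R..R} (\<lambda>x. g (Complex x R) - g (Complex x (-R)))"
proof -
  let ?gx = "\<lambda>w. frechet_derivative g (at w) 1"
  let ?gy = "\<lambda>w. frechet_derivative g (at w) \<i>"
  have cx: "continuous_on UNIV ?gx" and cy: "continuous_on UNIV ?gy"
    using g by (auto simp: C1_on_def)
  have D: "(g has_derivative frechet_derivative g (at w)) (at w)" for w
    using C1_on_has_derivative[OF g] by simp
  have lin: "linear (frechet_derivative g (at w))" for w
    using D has_derivative_linear by blast
  have "integral {-R..R} (\<lambda>x. ?gx (Complex x y)) = g (Complex R y) - g (Complex (-R) y)" for y
  proof (rule integral_unique, rule fundamental_theorem_of_calculus)
    fix x
    have "((\<lambda>x. Complex x y) has_derivative (\<lambda>t. of_real t)) (at x within {-R..R})"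
      unfolding Complex_eq by (auto intro!: derivative_eq_intros)
    from has_derivative_compose[OF this D]
    have "((\<lambda>x. g (Complex x y)) has_derivative (\<lambda>t. frechet_derivative g (at (Complex x y)) (of_real t)))
      (at x within {-R..R})" .
    moreover have "frechet_derivative g (at w) (of_real t) = t *\<^sub>R ?gx w" for w t
      using linear_scale[OF lin, of w t 1] by (simp add: scaleR_conv_of_real)
    ultimately show "((\<lambda>x. g (Complex x y)) has_vector_derivative ?gx (Complex x y)) (at x within {-R..R})"
      by (simp add: has_vector_derivative_def)
  qed (use R in auto)
  moreover have "integral {-R..R} (\<lambda>y. ?gy (Complex x y)) = g (Complex x R) - g (Complex x (-R))" for x
  proof (rule integral_unique, rule fundamental_theorem_of_calculus)
    fix y
    have "((\<lambda>y. Complex x y) has_derivative (\<lambda>t. \<i> * of_real t)) (at y within {-R..R})"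
      unfolding Complex_eq by (auto intro!: derivative_eq_intros)
    from has_derivative_compose[OF this D]
    have "((\<lambda>y. g (Complex x y)) has_derivative (\<lambda>t. frechet_derivative g (at (Complex x y)) (\<i> * of_real t)))
      (at y within {-R..R})" .
    moreover have "frechet_derivative g (at w) (\<i> * of_real t) = t *\<^sub>R ?gy w" for w t
      using linear_scale[OF lin, of w t \<i>] by (simp add: scaleR_conv_of_real mult.commute)
    ultimately show "((\<lambda>y. g (Complex x y)) has_vector_derivative ?gy (Complex x y)) (at y within {-R..R})"
      by (simp add: has_vector_derivative_def)
  qed (use R in auto)
  moreover have "area_integral R (dbar g) = area_integral R ?gx + \<i> * area_integral R ?gy"
    unfolding dbar_def[abs_def]
    by (subst area_integral_add[OF cx continuous_on_mult_left[OF cy]])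
      (simp add: area_integral_mult_left)
  ultimately show ?thesis
    unfolding area_integral_iterated(2)[OF cx] area_integral_iterated(1)[OF cy] by simp
qed

lemma contour_integral_linepath_same_Im:
  assumes "a < b"
  shows "contour_integral (linepath (Complex a c) (Complex b c)) f =
    integral {a..b} (\<lambda>x. f (Complex x c))"
proof -
  have l: "linepath (Complex a c) (Complex b c) x = linepath (of_real a) (of_real b) x + \<i> * of_real c" for x
    by (simp add: linepath_def complex_eq_iff algebra_simps)
  have "contour_integral (linepath (Complex a c) (Complex b c)) f =
     contour_integral (linepath (of_real a) (of_real b)) (\<lambda>w. f (w + \<i> * of_real c))"
    unfolding contour_integral_integral
    by (simp add: l) (simp add: Complex_eq)
  also have "\<dots> = integral {a..b} (\<lambda>x. f (of_real x + \<i> * of_real c))"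
    using contour_integral_linepath_Reals_eq[of "of_real a" "of_real b"] assms by simp
  finally show ?thesis by (simp add: Complex_eq)
qed

lemma contour_integral_rectpath_sides:
  assumes f: "continuous_on (path_image (rectpath (Complex a c) (Complex b d))) f"
    and ab: "a < b" "c < d"
  shows "contour_integral (rectpath (Complex a c) (Complex b d)) f =
    \<i> * (integral {c..d} (\<lambda>y. f (Complex b y)) - integral {c..d} (\<lambda>y. f (Complex a y)))
    - (integral {a..b} (\<lambda>x. f (Complex x d)) - integral {a..b} (\<lambda>x. f (Complex x c)))"
proof -
  have v: "contour_integral (linepath (Complex t c) (Complex t d)) f = \<i> * integral {c..d} (\<lambda>y. f (Complex t y))" for t
    by (rule contour_integral_linepath_same_Re) (use ab in auto)
  have seg: "closed_segment (Complex b d) (Complex a d) \<subseteq> path_image (rectpath (Complex a c) (Complex b d))"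
    "closed_segment (Complex a d) (Complex a c) \<subseteq> path_image (rectpath (Complex a c) (Complex b d))"
    unfolding rectpath_def Let_def by (auto simp: path_image_join)
  have int: "f contour_integrable_on linepath (Complex a c) (Complex b c)"
    "f contour_integrable_on linepath (Complex b c) (Complex b d)"
    "f contour_integrable_on linepath (Complex b d) (Complex a d)"
    "f contour_integrable_on linepath (Complex a d) (Complex a c)"
    using f unfolding rectpath_def Let_def
    by (auto simp: path_image_join intro!: contour_integrable_continuous_linepath elim: continuous_on_subset)
  have "contour_integral (rectpath (Complex a c) (Complex b d)) f =
    contour_integral (linepath (Complex a c) (Complex b c)) f
    + (contour_integral (linepath (Complex b c) (Complex b d)) f
    + (contour_integral (linepath (Complex b d) (Complex a d)) f
    + contour_integral (linepath (Complex a d) (Complex a c)) f))"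
    unfolding rectpath_def Let_def using int by simp
  also have "contour_integral (linepath (Complex b d) (Complex a d)) f = - integral {a..b} (\<lambda>x. f (Complex x d))"
    using contour_integral_reverse_linepath[OF continuous_on_subset[OF f seg(1)]]
    by (simp add: contour_integral_linepath_same_Im[OF ab(1)])
  also have "contour_integral (linepath (Complex a d) (Complex a c)) f = - (\<i> * integral {c..d} (\<lambda>y. f (Complex a y)))"
    using contour_integral_reverse_linepath[OF continuous_on_subset[OF f seg(2)]]
    by (simp add: v)
  finally show ?thesis
    by (simp add: v contour_integral_linepath_same_Im[OF ab(1)] algebra_simps)
qed

text \<open>The open square whose closure is the domain of \<open>area_integral R\<close>.\<close>

abbreviation square :: "real \<Rightarrow> complex set" where
  "square R \<equiv> box (Complex (-R) (-R)) (Complex R R)"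

lemma square_edges:
  "Complex R y \<notin> square R" "Complex (-R) y \<notin> square R"
  "Complex x R \<notin> square R" "Complex x (-R) \<notin> square R"
  by (auto simp: in_box_complex_iff)

text \<open>The product of a compactly supported function with a function that is holomorphic near the
  support extends by zero to the whole plane, and \<open>dbar\<close> acts on the first factor only. Off \<open>L\<close> the
  values of \<open>h\<close> play no role, because \<open>dbar \<phi>\<close> vanishes there.\<close>

lemma C1_on_extend_zero:
  assumes \<phi>: "C1_on UNIV \<phi>" and L: "closed L" "L \<subseteq> U" and U: "open U"
    and z: "\<And>w. w \<notin> L \<Longrightarrow> \<phi> w = 0" and h: "h holomorphic_on U"
  defines "g \<equiv> \<lambda>w. if w \<in> L then \<phi> w * h w else 0"
  shows "C1_on UNIV g" "dbar g = (\<lambda>w. dbar \<phi> w * h w)"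
proof -
  have gU: "\<phi> w * h w = g w" if "w \<in> U" for w
    using z by (auto simp: g_def)
  have gL: "0 = g w" if "w \<in> - L" for w
    using that by (auto simp: g_def)
  have hC: "C1_on U h" and \<phi>U: "C1_on U \<phi>"
    using holomorphic_imp_C1_on[OF h U] C1_on_subset[OF \<phi>] by auto
  have oL: "open (- L)"
    using L by auto
  have "C1_on U g"
    by (rule C1_on_cong[OF U gU C1_on_mult[OF \<phi>U hC]])
  moreover have "C1_on (- L) g"
    by (rule C1_on_cong[OF oL gL C1_on_const])
  moreover have "U \<union> - L = UNIV"
    using L by auto
  ultimately show "C1_on UNIV g"
    using C1_on_Un[OF U oL, of g] by simp
  show "dbar g = (\<lambda>w. dbar \<phi> w * h w)"
  proof
    fix w
    show "dbar g w = dbar \<phi> w * h w"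
    proof (cases "w \<in> U")
      case True
      then show ?thesis
        using dbar_cong[OF U True gU] dbar_mult[OF \<phi>U hC True] dbar_holomorphic[OF h U True] by simp
    next
      case False
      then have w: "w \<in> - L" using L by auto
      have "dbar g w = dbar (\<lambda>_. 0) w" "dbar \<phi> w = dbar (\<lambda>_. 0) w"
        using dbar_cong[OF oL w, of g "\<lambda>_. 0"] dbar_cong[OF oL w, of \<phi> "\<lambda>_. 0"] gL z by auto
      then show ?thesis by simp
    qed
  qed
qed

text \<open>Integration by parts against a holomorphic function leaves no boundary term.\<close>

lemma stokes:
  assumes "C1_on UNIV \<phi>" "closed L" "L \<subseteq> U" "open U"
    and "\<And>w. w \<notin> L \<Longrightarrow> \<phi> w = 0" and "h holomorphic_on U"
    and "R > 0" "L \<subseteq> square R"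
  shows "area_integral R (\<lambda>w. dbar \<phi> w * h w) = 0"
proof -
  define g where "g = (\<lambda>w. if w \<in> L then \<phi> w * h w else 0)"
  note g = C1_on_extend_zero[OF assms(1-6), folded g_def]
  have "g w = 0" if "w \<notin> square R" for w
    using that assms(8) by (auto simp: g_def)
  then have "g (Complex R y) = 0" "g (Complex (-R) y) = 0" "g (Complex x R) = 0" "g (Complex x (-R)) = 0" for x y
    by (simp_all add: square_edges)
  then show ?thesis
    using green_box[OF g(1) \<open>R > 0\<close>] by (simp flip: g(2))
qed

text \<open>The value does not depend on \<open>\<phi>\<close>: the function \<open>(1 - \<phi>) / (w - a)\<close> has no pole and agrees
  with the Cauchy kernel on the boundary of the square, so Green's formula reduces the area integral
  to the contour integral of the kernel, that is, to a winding number.\<close>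

lemma cauchy_kernel_integral:
  assumes \<phi>: "C1_on UNIV \<phi>" and L: "closed L" "L \<subseteq> square R"
    and z: "\<And>w. w \<notin> L \<Longrightarrow> \<phi> w = 0"
    and V: "open V" "a \<in> V" "\<And>w. w \<in> V \<Longrightarrow> \<phi> w = 1"
    and R: "R > 0"
  shows "area_integral R (\<lambda>w. dbar \<phi> w / (w - a)) = - 2 * pi"
proof -
  define g where "g = (\<lambda>w. (1 - \<phi> w) * inverse (w - a))"
  define U where "U = - {a}"
  have U: "open U" and UV: "V \<union> U = UNIV"
    using V by (auto simp: U_def)
  have h: "(\<lambda>w. inverse (w - a)) holomorphic_on U"
    unfolding U_def by (intro holomorphic_intros) auto
  note hC = holomorphic_imp_C1_on[OF h U]
  have 1: "C1_on U (\<lambda>w. 1 - \<phi> w)"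
    by (rule C1_on_diff[OF C1_on_const C1_on_subset[OF \<phi>]]) auto
  have gV: "0 = g w" if "w \<in> V" for w
    using that V by (simp add: g_def)
  have "C1_on V g"
    by (rule C1_on_cong[OF V(1) gV C1_on_const])
  moreover have "C1_on U g"
    unfolding g_def by (rule C1_on_mult[OF 1 hC])
  ultimately have gC: "C1_on UNIV g"
    using C1_on_Un[OF V(1) U, of g] UV by simp
  have dg: "dbar g w = (-1) * (dbar \<phi> w / (w - a))" for w
  proof (cases "w \<in> U")
    case True
    then show ?thesis
      using dbar_mult[OF 1 hC True] dbar_holomorphic[OF h U True] 
        dbar_diff[OF C1_on_const C1_on_subset[OF \<phi>] True, of 1]
      unfolding g_def by (simp add: divide_inverse)
  next
    case False
    then have w: "w \<in> V" "w = a" using V by (auto simp: U_def)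
    then show ?thesis using dbar_cong[OF V(1) w(1), of g "\<lambda>_. 0"] gV by simp
  qed
  have ga: "g w = 1 / (w - a)" if "w \<notin> square R" for w
    using that L z[of w] by (auto simp: g_def inverse_eq_divide)
  have a: "a \<in> square R"
    using z[of a] V L by auto
  let ?\<gamma> = "rectpath (Complex (-R) (-R)) (Complex R R)"
  let ?k = "\<lambda>w. 1 / (w - a)"
  have "path_image ?\<gamma> \<inter> square R = {}"
    using path_image_rectpath_inter_box[of "Complex (-R) (-R)" "Complex R R"] R by simp
  then have aI: "a \<notin> path_image ?\<gamma>"
    using a by auto
  have kc: "continuous_on (path_image ?\<gamma>) ?k"
    using aI by (auto intro!: continuous_intros)
  have "contour_integral ?\<gamma> ?k = 2 * pi * \<i>"
    using has_contour_integral_winding_number[OF valid_path_rectpath aI] winding_number_rectpath[OF a]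
    by (simp add: contour_integral_unique)
  then have *: "\<i> * (integral {-R..R} (\<lambda>y. ?k (Complex R y)) - integral {-R..R} (\<lambda>y. ?k (Complex (-R) y)))
    - (integral {-R..R} (\<lambda>x. ?k (Complex x R)) - integral {-R..R} (\<lambda>x. ?k (Complex x (-R)))) = 2 * pi * \<i>"
    using contour_integral_rectpath_sides[OF kc] R by simp
  have ne: "Complex R y \<noteq> a" "Complex (-R) y \<noteq> a" "Complex x R \<noteq> a" "Complex x (-R) \<noteq> a" for x y
    using a square_edges by metis+
  have int: "(\<lambda>y. ?k (Complex R y)) integrable_on {-R..R}" "(\<lambda>y. ?k (Complex (-R) y)) integrable_on {-R..R}"
    "(\<lambda>x. ?k (Complex x R)) integrable_on {-R..R}" "(\<lambda>x. ?k (Complex x (-R))) integrable_on {-R..R}"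
    using ne by (auto intro!: integrable_continuous_interval continuous_intros)
  have "(-1) * area_integral R (\<lambda>w. dbar \<phi> w / (w - a)) = area_integral R (dbar g)"
    by (simp only: dg[abs_def] area_integral_mult_left)
  also have "\<dots> = integral {-R..R} (\<lambda>y. ?k (Complex R y) - ?k (Complex (-R) y)) +
    \<i> * integral {-R..R} (\<lambda>x. ?k (Complex x R) - ?k (Complex x (-R)))"
    unfolding green_box[OF gC R] by (simp add: ga square_edges)
  also have "\<dots> = (integral {-R..R} (\<lambda>y. ?k (Complex R y)) - integral {-R..R} (\<lambda>y. ?k (Complex (-R) y))) +
    \<i> * (integral {-R..R} (\<lambda>x. ?k (Complex x R)) - integral {-R..R} (\<lambda>x. ?k (Complex x (-R))))"
    by (simp add: integral_diff int)
  also have "\<dots> = - \<i> * (2 * pi * \<i>)"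
    unfolding *[symmetric] by (simp add: algebra_simps)
  finally show ?thesis by simp
qed

text \<open>Cauchy's integral formula with the contour replaced by the transition region of a cutoff
  function. Splitting off the constant \<open>h a\<close> leaves the difference quotient of \<open>h\<close>, to which
  \<open>stokes\<close> applies.\<close>

lemma cauchy_pompeiu_cutoff:
  fixes h :: "complex \<Rightarrow> complex"
  assumes \<phi>: "C1_on UNIV \<phi>" and L: "closed L" "L \<subseteq> square R" "L \<subseteq> U"
    and z: "\<And>w. w \<notin> L \<Longrightarrow> \<phi> w = 0"
    and V: "open V" "a \<in> V" "\<And>w. w \<in> V \<Longrightarrow> \<phi> w = 1"
    and R: "R > 0" and U: "open U" and h: "h holomorphic_on U"
  shows "area_integral R (\<lambda>w. dbar \<phi> w * (h w / (w - a))) = - 2 * pi * h a"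
proof -
  define q where "q = (\<lambda>w. if w = a then deriv h a else (h w - h a) / (w - a))"
  have q: "q holomorphic_on U"
    unfolding q_def by (rule pole_lemma_open[OF h U])
  have dV: "dbar \<phi> w = 0" if "w \<in> V" for w
    using dbar_cong[OF V(1) that, of \<phi> "\<lambda>_. 1"] V by simp
  have c\<phi>: "continuous_on UNIV (dbar \<phi>)"
    using continuous_on_dbar[OF \<phi>] .
  have eq: "dbar \<phi> w * (h w / (w - a)) = dbar \<phi> w * q w + h a * (dbar \<phi> w / (w - a))" for w
  proof (cases "w = a")
    case False
    then have "h w / (w - a) = q w + h a * (1 / (w - a))"
      by (simp add: q_def diff_divide_distrib)
    then show ?thesis
      by (simp add: distrib_left)
  qed (use dV[of a] V in auto)
  have c1: "continuous_on UNIV (\<lambda>w. dbar \<phi> w * q w)"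
    using continuous_on_dbar[OF C1_on_extend_zero(1)[OF \<phi> L(1,3) U z q]]
      C1_on_extend_zero(2)[OF \<phi> L(1,3) U z q] by simp
  have c2: "continuous_on UNIV (\<lambda>w. dbar \<phi> w / (w - a))"
  proof -
    have "continuous_on V (\<lambda>w. dbar \<phi> w / (w - a))"
      by (rule continuous_on_eq[of _ "\<lambda>_. 0"]) (auto simp: dV)
    moreover have "continuous_on (- {a}) (\<lambda>w. dbar \<phi> w / (w - a))"
      by (intro continuous_intros continuous_on_subset[OF c\<phi>]) auto
    ultimately have "continuous_on (V \<union> - {a}) (\<lambda>w. dbar \<phi> w / (w - a))"
      by (intro continuous_on_open_Un) (use V in auto)
    moreover have "V \<union> - {a} = UNIV" using V by auto
    ultimately show ?thesis by simp
  qed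
  have "area_integral R (\<lambda>w. dbar \<phi> w * (h w / (w - a))) =
    area_integral R (\<lambda>w. dbar \<phi> w * q w) + h a * area_integral R (\<lambda>w. dbar \<phi> w / (w - a))"
    unfolding eq area_integral_add[OF c1 continuous_on_mult_left[OF c2]] area_integral_mult_left ..
  also have "\<dots> = - 2 * pi * h a"
    using stokes[OF \<phi> L(1,3) U z q R L(2)] cauchy_kernel_integral[OF \<phi> L(1,2) z V R] by simp
  finally show ?thesis .
qed

section \<open>Cutoff functions\<close>

text \<open>A continuously differentiable function that is 1 in a neighbourhood of \<open>A\<close> and whose support is a
  compact subset of \<open>U\<close>. No bounds on the values in between are needed.\<close>

definition cutoff :: "complex set \<Rightarrow> complex set \<Rightarrow> (complex \<Rightarrow> complex) \<Rightarrow> bool" where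
  "cutoff A U \<phi> \<longleftrightarrow> C1_on UNIV \<phi> \<and>
     (\<exists>V L. open V \<and> A \<subseteq> V \<and> (\<forall>w\<in>V. \<phi> w = 1) \<and> compact L \<and> L \<subseteq> U \<and> (\<forall>w. w \<notin> L \<longrightarrow> \<phi> w = 0))"

lemma cutoff_Un:
  assumes "cutoff A U \<phi>" "cutoff B U \<psi>"
  shows "cutoff (A \<union> B) U (\<lambda>w. 1 - (1 - \<phi> w) * (1 - \<psi> w))"
proof -
  obtain V L where 1: "open V" "A \<subseteq> V" "\<forall>w\<in>V. \<phi> w = 1" "compact L" "L \<subseteq> U" "\<forall>w. w \<notin> L \<longrightarrow> \<phi> w = 0"
    using assms(1) unfolding cutoff_def by auto
  obtain V' L' where 2: "open V'" "B \<subseteq> V'" "\<forall>w\<in>V'. \<psi> w = 1" "compact L'" "L' \<subseteq> U" "\<forall>w. w \<notin> L' \<longrightarrow> \<psi> w = 0"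
    using assms(2) unfolding cutoff_def by auto
  have "C1_on UNIV (\<lambda>w. 1 - (1 - \<phi> w) * (1 - \<psi> w))"
    using assms by (intro C1_on_diff C1_on_mult C1_on_const) (auto simp: cutoff_def)
  moreover have "open (V \<union> V')" "A \<union> B \<subseteq> V \<union> V'" "compact (L \<union> L')" "L \<union> L' \<subseteq> U"
    using 1 2 by auto
  ultimately show ?thesis
    unfolding cutoff_def using 1(3,6) 2(3,6)
    by (intro conjI exI[of _ "V \<union> V'"] exI[of _ "L \<union> L'"]) auto
qed

lemma cutoff_subset: "cutoff A U \<phi> \<Longrightarrow> B \<subseteq> A \<Longrightarrow> cutoff B U \<phi>"
  unfolding cutoff_def by (meson subset_trans)

lemma has_real_derivative_max_square:
  "((\<lambda>t. (max 0 t)\<^sup>2) has_real_derivative 2 * max 0 t) (at t)"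
proof (cases "t = 0")
  case True
  have "((\<lambda>h::real. (max 0 h)\<^sup>2 / h) \<longlongrightarrow> 0) (at 0)"
  proof (rule Lim_null_comparison)
    show "\<forall>\<^sub>F h in at 0. norm ((max 0 h)\<^sup>2 / h) \<le> \<bar>h::real\<bar>"
      by (rule always_eventually) (auto simp: max_def power2_eq_square)
    show "((\<lambda>h::real. \<bar>h\<bar>) \<longlongrightarrow> 0) (at 0)"
      by (rule tendsto_rabs_zero[OF tendsto_ident_at])
  qed
  then show ?thesis
    using True by (simp add: DERIV_def)
next
  case False
  show ?thesis
  proof (cases "t > 0")
    case True
    have "((\<lambda>t::real. t\<^sup>2) has_real_derivative 2 * t) (at t)"
      by (auto intro!: derivative_eq_intros)
    then have "((\<lambda>t. (max 0 t)\<^sup>2) has_real_derivative 2 * t) (at t)"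
      by (rule has_field_derivative_transform_within_open[of _ _ _ "{0<..}"]) (use True in auto)
    then show ?thesis
      using True by simp
  next
    case F: False
    have "((\<lambda>t::real. 0) has_real_derivative 0) (at t)"
      by auto
    then have "((\<lambda>t. (max 0 t)\<^sup>2) has_real_derivative 0) (at t)"
      by (rule has_field_derivative_transform_within_open[of _ _ _ "{..<0}"]) (use F False in auto)
    then show ?thesis
      by (subst max_absorb1) (use F in auto)
  qed
qed

lemma cutoff_ball:
  assumes r: "r > 0"
  shows "\<exists>\<phi>. cutoff (ball a r) (ball a (2 * r)) \<phi>"
proof -
  \<comment> \<open>\<open>p\<close> is continuously differentiable, \<open>p t \<ge> 1\<close> for \<open>t \<ge> 1\<close>, and \<open>1 - p (1 - s)\<close> is 0 at
    \<open>s = 0\<close> and 1 for \<open>s \<ge> 1\<close>; the composite is 1 where \<open>u \<ge> 1\<close> and 0 where \<open>u \<le> 0\<close>.\<close>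
  define p where "p = (\<lambda>t::real. (max 0 t)\<^sup>2)"
  define u where "u = (\<lambda>w. 2 - ((w - a) \<bullet> (w - a)) / r\<^sup>2)"
  define \<phi> where "\<phi> = (\<lambda>w. complex_of_real (1 - p (1 - p (u w))))"
  define d where "d = (\<lambda>w. 4 * max 0 (1 - p (u w)) * max 0 (u w))"
  have pd: "(p has_real_derivative 2 * max 0 t) (at t)" for t
    unfolding p_def by (rule has_real_derivative_max_square)
  have ud: "(u has_derivative (\<lambda>h. - (2 * ((w - a) \<bullet> h) / r\<^sup>2))) (at w)" for w
    unfolding u_def using r by (auto intro!: derivative_eq_intros simp: inner_commute field_simps)
  have "((\<lambda>t. 1 - p (1 - p t)) has_real_derivative 4 * max 0 (1 - p t) * max 0 t) (at t)" for t
    by (auto intro!: derivative_eq_intros DERIV_chain2[OF pd] pd)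
  then have "((\<lambda>w. 1 - p (1 - p (u w))) has_derivative (\<lambda>h. d w * (- (2 * ((w - a) \<bullet> h) / r\<^sup>2)))) (at w)" for w
    using has_derivative_compose[OF ud] unfolding has_field_derivative_def d_def by blast
  then have \<phi>d: "(\<phi> has_derivative (\<lambda>h. of_real (d w * (- (2 * ((w - a) \<bullet> h) / r\<^sup>2))))) (at w)" for w
    unfolding \<phi>_def by (rule has_derivative_of_real)
  have "continuous_on UNIV (\<lambda>w. complex_of_real (d w * (- (2 * ((w - a) \<bullet> h) / r\<^sup>2))))" for h
    unfolding d_def p_def u_def using r by (auto intro!: continuous_intros)
  then have C: "C1_on UNIV \<phi>"
    by (intro C1_onI[OF \<phi>d])
  have nn: "(w - a) \<bullet> (w - a) = (dist a w)\<^sup>2" for w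
    by (subst dist_commute) (simp add: dist_norm power2_norm_eq_inner)
  have 1: "\<phi> w = 1" if "w \<in> ball a r" for w
  proof -
    have "(dist a w)\<^sup>2 \<le> r\<^sup>2"
      using that by (intro power_mono) auto
    then have "u w \<ge> 1"
      using r unfolding u_def nn by (simp add: field_simps)
    then have "p (u w) \<ge> 1"
      by (simp add: p_def)
    then show ?thesis by (simp add: \<phi>_def p_def)
  qed
  have 0: "\<phi> w = 0" if "w \<notin> cball a (3/2 * r)" for w
  proof -
    have "(3/2 * r)\<^sup>2 \<le> (dist a w)\<^sup>2"
      using that r by (intro power_mono) auto
    moreover have "2 * r\<^sup>2 \<le> (3/2 * r)\<^sup>2"
      using r by (simp add: power2_eq_square)
    ultimately have "2 * r\<^sup>2 \<le> (dist a w)\<^sup>2"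
      by linarith
    then have "u w \<le> 0"
      using r unfolding u_def nn by (simp add: field_simps)
    then show ?thesis by (simp add: \<phi>_def p_def)
  qed
  have "cball a (3/2 * r) \<subseteq> ball a (2 * r)"
    using r by auto
  then show ?thesis
    unfolding cutoff_def using C 1 0
    by (intro exI[of _ \<phi>] conjI exI[of _ "ball a r"] exI[of _ "cball a (3/2 * r)"]) auto
qed

lemma cutoff_mono: "cutoff A U \<phi> \<Longrightarrow> U \<subseteq> U' \<Longrightarrow> cutoff A U' \<phi>"
  unfolding cutoff_def by (meson subset_trans)

text \<open>Finitely many balls cover \<open>K\<close>, and cutoff functions of two sets combine to one of their
  union.\<close>

lemma cutoff_exists:
  assumes K: "compact K" and U: "open U" "K \<subseteq> U"
  shows "\<exists>\<phi>. cutoff K U \<phi>"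
proof -
  have "\<forall>a\<in>K. \<exists>r>0. ball a (2 * r) \<subseteq> U"
  proof
    fix a assume "a \<in> K"
    then obtain e where "e > 0" "ball a e \<subseteq> U"
      using U openE by blast
    then show "\<exists>r>0. ball a (2 * r) \<subseteq> U"
      by (intro exI[of _ "e/2"]) auto
  qed
  then obtain r where r: "\<And>a. a \<in> K \<Longrightarrow> r a > 0" "\<And>a. a \<in> K \<Longrightarrow> ball a (2 * r a) \<subseteq> U"
    by metis
  obtain C where C: "C \<subseteq> K" "finite C" "K \<subseteq> (\<Union>a\<in>C. ball a (r a))"
    by (rule compactE_image[OF K, of K "\<lambda>a. ball a (r a)"]) (use r in force)+
  have "\<exists>\<phi>. cutoff (\<Union>a\<in>C. ball a (r a)) U \<phi>"
    using C(2,1)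
  proof (induction C)
    case empty
    have "cutoff {} U (\<lambda>_. 0)"
      unfolding cutoff_def by (auto intro!: C1_on_const exI[of _ "{}"])
    then show ?case by auto
  next
    case (insert a C)
    then obtain \<phi> where "cutoff (\<Union>a\<in>C. ball a (r a)) U \<phi>"
      by auto
    moreover obtain \<psi> where "cutoff (ball a (r a)) U \<psi>"
      using cutoff_ball[of "r a" a] r[of a] insert.prems cutoff_mono by blast
    ultimately show ?case
      using cutoff_Un[of "ball a (r a)" U \<psi>] by auto
  qed
  then show ?thesis
    using cutoff_subset C(3) by blast
qed

section \<open>Integrals depending holomorphically on a parameter\<close>

text \<open>By Morera's theorem: the integral over a triangle may be taken under the integral sign.\<close>

lemma holomorphic_parameter_integral:
  fixes M :: "complex \<Rightarrow> 'a::euclidean_space \<Rightarrow> complex"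
  assumes U: "open U" and c: "continuous_on (U \<times> cbox a b) (\<lambda>(z, t). M z t)"
    and h: "\<And>t. t \<in> cbox a b \<Longrightarrow> (\<lambda>z. M z t) holomorphic_on U"
  shows "(\<lambda>z. integral (cbox a b) (M z)) holomorphic_on U"
proof -
  have side: "contour_integral (linepath p q) (\<lambda>z. integral (cbox a b) (M z)) =
      integral (cbox a b) (\<lambda>t. contour_integral (linepath p q) (\<lambda>z. M z t))"
    and cont: "continuous_on (cbox a b) (\<lambda>t. contour_integral (linepath p q) (\<lambda>z. M z t))"
    if pq: "closed_segment p q \<subseteq> U" for p q
  proof -
    have l: "linepath p q s \<in> U" if "s \<in> {0..1}" for s
      using pq that linepath_in_path by blast
    have "continuous_on (cbox (0, a) (1, b)) (\<lambda>x. (\<lambda>(z, t). M z t) (linepath p q (fst x), snd x))"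
      by (rule continuous_on_compose2[OF c]) (use l in \<open>auto simp: cbox_Pair_eq intro!: continuous_intros continuous_on_compose2[OF continuous_on_linepath[of UNIV]]\<close>)
    then have c': "continuous_on (cbox (0, a) (1, b)) (\<lambda>(s, t). M (linepath p q s) t)"
      by (simp add: case_prod_unfold)
    have "continuous_on (cbox a b \<times> cbox 0 1) (\<lambda>x. (\<lambda>(z, t). M z t) (linepath p q (snd x), fst x))"
      by (rule continuous_on_compose2[OF c]) (use l in \<open>auto intro!: continuous_intros continuous_on_compose2[OF continuous_on_linepath[of UNIV]]\<close>)
    then have c'': "continuous_on (cbox a b \<times> cbox 0 1) (\<lambda>(t, s). M (linepath p q s) t)"
      by (simp add: case_prod_unfold)
    have "integral {0..1} (\<lambda>s. integral (cbox a b) (\<lambda>t. M (linepath p q s) t)) =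
       integral (cbox a b) (\<lambda>t. integral {0..1} (\<lambda>s. M (linepath p q s) t))"
      using integral_swap_continuous[OF c'] by simp
    then show "contour_integral (linepath p q) (\<lambda>z. integral (cbox a b) (M z)) =
      integral (cbox a b) (\<lambda>t. contour_integral (linepath p q) (\<lambda>z. M z t))"
      by (simp add: contour_integral_integral)
    show "continuous_on (cbox a b) (\<lambda>t. contour_integral (linepath p q) (\<lambda>z. M z t))"
      using integral_continuous_on_param[OF c'']
      by (simp add: contour_integral_integral continuous_on_mult_right)
  qed
  have "(\<lambda>z. integral (cbox a b) (M z)) analytic_on U"
  proof (rule Morera_triangle[OF integral_continuous_on_param[OF c] U], intro impI)
    fix p q r :: complex
    assume T: "convex hull {p, q, r} \<subseteq> U"
    then have seg: "closed_segment p q \<subseteq> U" "closed_segment q r \<subseteq> U" "closed_segment r p \<subseteq> U"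
      using segments_subset_convex_hull(1)[of p q r] segments_subset_convex_hull(1)[of q r p]
        segments_subset_convex_hull(1)[of r p q] by (simp_all add: insert_commute subset_iff)
    note i = seg[THEN cont, THEN integrable_continuous]
    have "contour_integral (linepath p q) (\<lambda>z. M z t) + contour_integral (linepath q r) (\<lambda>z. M z t)
       + contour_integral (linepath r p) (\<lambda>z. M z t) = 0" if "t \<in> cbox a b" for t
    proof -
      have hT: "(\<lambda>z. M z t) holomorphic_on convex hull {p, q, r}"
        using h[OF that] T holomorphic_on_subset by blast
      have "continuous_on U (\<lambda>z. M z t)"
        using h[OF that] by (rule holomorphic_on_imp_continuous_on)
      then have "(\<lambda>z. M z t) contour_integrable_on linepath p q" "(\<lambda>z. M z t) contour_integrable_on linepath q r"
        "(\<lambda>z. M z t) contour_integrable_on linepath r p"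
        using seg by (auto intro!: contour_integrable_continuous_linepath elim: continuous_on_subset)
      then show ?thesis
        using contour_integral_unique[OF Cauchy_theorem_triangle[OF hT]] by (simp add: add.assoc)
    qed
    then have "integral (cbox a b) (\<lambda>t. contour_integral (linepath p q) (\<lambda>z. M z t)
       + contour_integral (linepath q r) (\<lambda>z. M z t) + contour_integral (linepath r p) (\<lambda>z. M z t)) = 0"
      by (simp add: integral_cong[of _ _ "\<lambda>_. 0"])
    then show "contour_integral (linepath p q) (\<lambda>z. integral (cbox a b) (M z)) +
      contour_integral (linepath q r) (\<lambda>z. integral (cbox a b) (M z)) +
      contour_integral (linepath r p) (\<lambda>z. integral (cbox a b) (M z)) = 0"
      using i by (simp add: side seg integral_add integrable_add)
  qed
  then show ?thesis
    by (rule analytic_imp_holomorphic)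
qed

section \<open>Separately holomorphic functions of several variables\<close>

text \<open>The symbol \<open>$\<close> denotes vector components only; its use for coefficients of formal power series
  would make every such term ambiguous.\<close>

no_notation fps_nth (infixl \<open>$\<close> 75)

lemma subst_coord_nth [simp]: "subst_coord z i w $ j = (if j = i then w else z $ j)"
  by (simp add: subst_coord_def)

lemma subst_coord_same [simp]: "subst_coord z i (z $ i) = z"
  by (simp add: vec_eq_iff)

lemma subst_coord_idem [simp]: "subst_coord (subst_coord z i v) i w = subst_coord z i w"
  by (simp add: vec_eq_iff)

lemma subst_coord_swap:
  "i \<noteq> j \<Longrightarrow> subst_coord (subst_coord z i v) j w = subst_coord (subst_coord z j w) i v"
  by (auto simp: vec_eq_iff)

lemma continuous_on_subst_coord [continuous_intros]:
  assumes "continuous_on S f" "continuous_on S g"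
  shows "continuous_on S (\<lambda>x. subst_coord (f x) i (g x))"
  unfolding subst_coord_def
proof (rule continuous_on_vec_lambda)
  fix j
  show "continuous_on S (\<lambda>x. if j = i then g x else f x $ j)"
    by (cases "j = i") (auto intro!: continuous_intros assms)
qed

lemma open_Collect_subst_coord:
  assumes "open U"
  shows "open {w. subst_coord z i w \<in> U}"
  using open_vimage[OF assms, of "subst_coord z i"]
  by (simp add: vimage_def continuous_on_subst_coord continuous_on_const continuous_on_id)

text \<open>In contrast to the definition, \<open>z\<close> need not lie in \<open>U\<close>.\<close>

lemma holomorphic_Cn_on_slice:
  assumes "f holomorphic_Cn_on U"
  shows "(\<lambda>w. f (subst_coord z i w)) holomorphic_on {w. subst_coord z i w \<in> U}"
proof (cases "\<exists>v. subst_coord z i v \<in> U")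
  case True
  then obtain v where "subst_coord z i v \<in> U" ..
  with assms have "(\<lambda>w. f (subst_coord (subst_coord z i v) i w)) holomorphic_on
      {w. subst_coord (subst_coord z i v) i w \<in> U}"
    unfolding holomorphic_Cn_on_def by blast
  then show ?thesis by simp
next
  case False
  then show ?thesis
    by (simp add: holomorphic_on_def)
qed

lemma holomorphic_Cn_on_subset:
  assumes "f holomorphic_Cn_on U" "V \<subseteq> U"
  shows "f holomorphic_Cn_on V"
  unfolding holomorphic_Cn_on_def
proof (intro conjI ballI allI)
  show "continuous_on V f"
    using assms continuous_on_subset unfolding holomorphic_Cn_on_def by blast
  show "(\<lambda>w. f (subst_coord z i w)) holomorphic_on {w. subst_coord z i w \<in> V}" for z i
    by (rule holomorphic_on_subset[OF holomorphic_Cn_on_slice[OF assms(1)]]) (use assms(2) in auto)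
qed

lemma holomorphic_Cn_on_cong:
  assumes "\<And>z. z \<in> U \<Longrightarrow> f z = g z" "f holomorphic_Cn_on U"
  shows "g holomorphic_Cn_on U"
  unfolding holomorphic_Cn_on_def
proof (intro conjI ballI allI)
  show "continuous_on U g"
    using assms continuous_on_eq unfolding holomorphic_Cn_on_def by blast
  show "(\<lambda>w. g (subst_coord z i w)) holomorphic_on {w. subst_coord z i w \<in> U}" for z i
    using holomorphic_transform[OF holomorphic_Cn_on_slice[OF assms(2), of z i]] assms(1) by simp
qed

lemma holomorphic_Cn_on_diff:
  assumes "f holomorphic_Cn_on U" "g holomorphic_Cn_on U"
  shows "(\<lambda>z. f z - g z) holomorphic_Cn_on U"
  using assms unfolding holomorphic_Cn_on_def by (auto intro!: continuous_on_diff holomorphic_on_diff)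

lemma holomorphic_Cn_on_local:
  assumes "\<And>z. z \<in> U \<Longrightarrow> \<exists>N. open N \<and> z \<in> N \<and> f holomorphic_Cn_on N"
  shows "f holomorphic_Cn_on U"
  unfolding holomorphic_Cn_on_def
proof (intro conjI ballI allI)
  have "isCont f z" if "z \<in> U" for z
    using assms[OF that] unfolding holomorphic_Cn_on_def
    by (auto simp: continuous_on_eq_continuous_at)
  then show "continuous_on U f"
    by (simp add: continuous_at_imp_continuous_on)
  fix z i
  show "(\<lambda>w. f (subst_coord z i w)) holomorphic_on {w. subst_coord z i w \<in> U}"
    unfolding holomorphic_on_def
  proof
    fix w assume "w \<in> {w. subst_coord z i w \<in> U}"
    then obtain N where N: "open N" "subst_coord z i w \<in> N" "f holomorphic_Cn_on N"
      using assms by blast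
    then have "(\<lambda>w. f (subst_coord z i w)) field_differentiable at w"
      using holomorphic_on_imp_differentiable_at[OF holomorphic_Cn_on_slice[OF N(3)] open_Collect_subst_coord] by blast
    then show "(\<lambda>w. f (subst_coord z i w)) field_differentiable (at w within {w. subst_coord z i w \<in> U})"
      by (rule field_differentiable_at_within)
  qed
qed

text \<open>The open polydisc with centre \<open>a\<close> and the same radius \<open>r\<close> in every coordinate.\<close>

definition polydisc :: "complex^'n \<Rightarrow> real \<Rightarrow> (complex^'n) set" where
  "polydisc a r = {z. \<forall>j. z $ j \<in> ball (a $ j) r}"

lemma open_polydisc:
  fixes a :: "complex^'n"
  shows "open (polydisc a r)"
proof -
  have "open ((\<lambda>z::complex^'n. z $ j) -` ball (a $ j) r)" for j
    by (rule open_vimage) (auto intro!: continuous_intros)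
  then have "open (\<Inter>j\<in>UNIV. (\<lambda>z::complex^'n. z $ j) -` ball (a $ j) r)"
    by (intro open_INT) auto
  moreover have "(\<Inter>j\<in>UNIV. (\<lambda>z::complex^'n. z $ j) -` ball (a $ j) r) = polydisc a r"
    by (auto simp: polydisc_def)
  ultimately show ?thesis by simp
qed

lemma open_contains_polydisc:
  fixes U :: "(complex^'n) set"
  assumes "open U" "a \<in> U"
  obtains r where "r > 0" "polydisc a r \<subseteq> U"
proof -
  obtain e where e: "e > 0" "ball a e \<subseteq> U"
    using assms openE by blast
  define r where "r = e / CARD('n)"
  have r: "r > 0" using e by (simp add: r_def)
  have "dist a z < e" if "\<And>j. dist (a $ j) (z $ j) < r" for z
  proof -
    have "dist a z \<le> (\<Sum>j\<in>UNIV. dist (a $ j) (z $ j))"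
      unfolding dist_vec_def by (rule L2_set_le_sum) auto
    also have "\<dots> < (\<Sum>j\<in>(UNIV::'n set). r)"
      by (rule sum_strict_mono) (use that in auto)
    also have "\<dots> = e" by (simp add: r_def)
    finally show ?thesis .
  qed
  then have "polydisc a r \<subseteq> U"
    using e(2) by (auto simp: polydisc_def)
  with r show thesis by (rule that)
qed

text \<open>Zeros spread through a polydisc one coordinate at a time, each step being the identity theorem in
  one variable. Only separate holomorphy enters.\<close>

lemma holomorphic_Cn_eq_0_polydisc:
  fixes u :: "complex^'n \<Rightarrow> complex"
  assumes u: "u holomorphic_Cn_on D" and P: "polydisc c r \<subseteq> D"
    and W: "open W" "\<And>z. z \<in> W \<Longrightarrow> u z = 0" and a: "a \<in> W" "a \<in> polydisc c r"
    and z: "z \<in> polydisc c r"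
  shows "u z = 0"
proof -
  obtain e where e: "e > 0" "polydisc a e \<subseteq> W"
    using open_contains_polydisc[OF W(1) a(1)] by blast
  \<comment> \<open>The coordinates in \<open>I\<close> range over the whole polydisc, the others stay close to \<open>a\<close>.\<close>
  have "\<forall>z. (\<forall>j. z $ j \<in> ball (c $ j) r) \<longrightarrow> (\<forall>j. j \<notin> I \<longrightarrow> z $ j \<in> ball (a $ j) e) \<longrightarrow> u z = 0"
    if "finite I" for I :: "'n set"
    using that
  proof (induction I)
    case empty
    then show ?case using e(2) W(2) by (auto simp: polydisc_def)
  next
    case (insert i I)
    show ?case
    proof (intro allI impI)
      fix z :: "complex^'n"
      assume z: "\<forall>j. z $ j \<in> ball (c $ j) r" "\<forall>j. j \<notin> insert i I \<longrightarrow> z $ j \<in> ball (a $ j) e"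
      have "(\<lambda>w. u (subst_coord z i w)) holomorphic_on ball (c $ i) r"
        by (rule holomorphic_on_subset[OF holomorphic_Cn_on_slice[OF u]]) (use P z in \<open>auto simp: polydisc_def\<close>)
      moreover have "u (subst_coord z i w) = 0" if "w \<in> ball (a $ i) e \<inter> ball (c $ i) r" for w
        using insert.IH[rule_format, of "subst_coord z i w"] that z by auto
      moreover have "a $ i \<in> ball (a $ i) e \<inter> ball (c $ i) r"
        using e(1) a(2) by (simp add: polydisc_def)
      ultimately have "u (subst_coord z i (z $ i)) = 0"
        using analytic_continuation_open[of "ball (a $ i) e \<inter> ball (c $ i) r" "ball (c $ i) r"
            "\<lambda>w. u (subst_coord z i w)" "\<lambda>_. 0" "z $ i"] z(1)
        by (metis connected_ball empty_iff holomorphic_on_const inf_le2 open_Int open_ball)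
      then show "u z = 0" by simp
    qed
  qed
  from this[of UNIV] z show ?thesis by (simp add: polydisc_def)
qed

text \<open>The interior of the set where \<open>u = v\<close> is open and closed in \<open>D\<close>.\<close>

lemma holomorphic_Cn_identity:
  fixes u v :: "complex^'n \<Rightarrow> complex"
  assumes D: "open D" "connected D" and uv: "u holomorphic_Cn_on D" "v holomorphic_Cn_on D"
    and W: "open W" "W \<noteq> {}" "W \<subseteq> D" "\<And>z. z \<in> W \<Longrightarrow> u z = v z" and z: "z \<in> D"
  shows "u z = v z"
proof -
  define f where "f = (\<lambda>z. u z - v z)"
  have f: "f holomorphic_Cn_on D"
    unfolding f_def by (rule holomorphic_Cn_on_diff[OF uv])
  define Z where "Z = interior {z \<in> D. f z = 0}"
  have ZD: "Z \<subseteq> D" "open Z" "\<And>z. z \<in> Z \<Longrightarrow> f z = 0"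
    unfolding Z_def using interior_subset by auto
  have "W \<subseteq> Z"
    unfolding Z_def by (rule interior_maximal) (use W in \<open>auto simp: f_def\<close>)
  then have "Z \<noteq> {}" using W by auto
  moreover have "openin (top_of_set D) Z"
    using ZD D by (simp add: openin_open_eq)
  moreover have "closedin (top_of_set D) Z"
    unfolding closedin_limpt
  proof (intro conjI ZD allI impI)
    fix c assume c: "c islimpt Z \<and> c \<in> D"
    obtain r where r: "r > 0" "polydisc c r \<subseteq> D"
      using open_contains_polydisc[OF D(1)] c by blast
    let ?P = "polydisc c r"
    have "c \<in> ?P" using r by (simp add: polydisc_def)
    then obtain a where a: "a \<in> Z" "a \<in> ?P"
      using c open_polydisc[of c r] unfolding islimpt_def by blast
    have "f z = 0" if "z \<in> ?P" for z
      by (rule holomorphic_Cn_eq_0_polydisc[OF f r(2) ZD(2,3)]) (use a that in auto)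
    then have "?P \<subseteq> Z"
      unfolding Z_def by (intro interior_maximal open_polydisc) (use r(2) in auto)
    then show "c \<in> Z" using \<open>c \<in> ?P\<close> by blast
  qed
  ultimately have "Z = D"
    using D(2) unfolding connected_clopen by blast
  then show ?thesis
    using ZD(3) z by (auto simp: f_def)
qed

section \<open>The extension by Cauchy integrals over slices\<close>

lemma continuous_on_mult_supported:
  fixes d h :: "'a::topological_space \<Rightarrow> complex"
  assumes "open T" "open U" "closed A" and d: "continuous_on T d" "\<And>x. x \<in> T - A \<Longrightarrow> d x = 0"
    and h: "continuous_on U h" "T \<inter> A \<subseteq> U"
  shows "continuous_on T (\<lambda>x. d x * h x)"
proof -
  have "continuous_on (T \<inter> U) (\<lambda>x. d x * h x)"
    by (intro continuous_on_mult continuous_on_subset[OF d(1)] continuous_on_subset[OF h(1)]) auto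
  moreover have "continuous_on (T \<inter> - A) (\<lambda>x. d x * h x)"
    by (rule continuous_on_eq[OF continuous_on_const[of _ 0]]) (use d(2) in auto)
  ultimately have "continuous_on (T \<inter> U \<union> T \<inter> - A) (\<lambda>x. d x * h x)"
    using assms by (intro continuous_on_open_Un open_Int) auto
  moreover have "T \<inter> U \<union> T \<inter> - A = T"
    using h(2) by auto
  ultimately show ?thesis by simp
qed

text \<open>The section of \<open>S\<close> by the complex line through \<open>z\<close> in the direction of coordinate \<open>i\<close>, as a set of
  values of that coordinate. It does not depend on \<open>z $ i\<close>.\<close>

definition slice :: "(complex^'n) set \<Rightarrow> 'n \<Rightarrow> complex^'n \<Rightarrow> complex set" where
  "slice S i z = {w. subst_coord z i w \<in> S}"

lemma open_slice: "open U \<Longrightarrow> open (slice U i z)"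
  unfolding slice_def by (rule open_Collect_subst_coord)

text \<open>A compact set contained in the slice at \<open>z0\<close> is contained in all slices at nearby points.\<close>

lemma slice_tube:
  fixes z0 :: "complex^'n"
  assumes C: "compact C" and W: "open W" and sub: "C \<subseteq> slice W i z0"
  obtains N where "open N" "z0 \<in> N" "\<And>z. z \<in> N \<Longrightarrow> C \<subseteq> slice W i z"
proof (cases "C = {}")
  case True
  then show thesis using that[of UNIV] by auto
next
  case False
  let ?U = "(\<lambda>x. subst_coord (snd x) i (fst x)) -` W"
  have "open ?U"
    by (rule open_vimage[OF W]) (intro continuous_intros)
  then have ope: "openin (top_of_set (C \<times> UNIV)) ((C \<times> UNIV) \<inter> ?U)"
    by (simp add: openin_open_Int)
  have im: "(\<lambda>x. (x, z0)) ` C \<subseteq> (C \<times> UNIV) \<inter> ?U"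
    using sub by (auto simp: slice_def)
  obtain N where "openin (top_of_set UNIV) N" "z0 \<in> N" "C \<times> N \<subseteq> (C \<times> UNIV) \<inter> ?U"
    by (rule tube_lemma[OF C False im ope])
  then show thesis
    by (intro that[of N]) (auto simp: slice_def)
qed

text \<open>The Cauchy integral of \<open>f\<close> at \<open>z\<close> over the slice through \<open>z\<close>, with the cutoff function \<open>\<phi>\<close> in place
  of a contour. Where \<open>dbar \<phi>\<close> vanishes, the integrand is 0 whatever value \<open>f\<close> takes.\<close>

definition hartogs_integral ::
    "real \<Rightarrow> 'n \<Rightarrow> (complex^'n \<Rightarrow> complex) \<Rightarrow> (complex \<Rightarrow> complex) \<Rightarrow> complex^'n \<Rightarrow> complex" where
  "hartogs_integral R i f \<phi> z =
     - area_integral R (\<lambda>w. dbar \<phi> w * (f (subst_coord z i w) / (w - z $ i))) / (2 * pi)"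

text \<open>The Cauchy integral for a cutoff function that is 1 near the slice of \<open>K\<close> and near \<open>z $ i\<close> itself.
  The choice of the cutoff function does not matter, by \<open>hartogs_integral_cutoff_indep\<close>.\<close>

definition hartogs_extension ::
    "(complex^'n) set \<Rightarrow> (complex^'n) set \<Rightarrow> real \<Rightarrow> 'n \<Rightarrow> (complex^'n \<Rightarrow> complex) \<Rightarrow> complex^'n \<Rightarrow> complex" where
  "hartogs_extension \<Omega> K R i f z =
     hartogs_integral R i f (SOME \<phi>. cutoff (insert (z $ i) (slice K i z)) (slice \<Omega> i z) \<phi>) z"

lemma dbar_supported:
  assumes "open V" "\<And>w. w \<in> V \<Longrightarrow> \<phi> w = 1" "closed L" "\<And>w. w \<notin> L \<Longrightarrow> \<phi> w = 0" "w \<notin> L - V"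
  shows "dbar \<phi> w = 0"
proof (cases "w \<in> V")
  case True
  then show ?thesis using dbar_cong[OF assms(1) True, of \<phi> "\<lambda>_. 1"] assms(2) by simp
next
  case False
  then have "w \<in> - L" using assms(5) by auto
  then show ?thesis using dbar_cong[of "- L" w \<phi> "\<lambda>_. 0"] assms(3,4) by auto
qed

text \<open>A function on \<open>\<Omega> - K\<close>, a coordinate \<open>i\<close> along which slices are taken, and a square that contains
  all slices of \<open>\<Omega>\<close>.\<close>

locale hartogs_data =
  fixes \<Omega> K :: "(complex^'n) set" and R :: real and i :: 'n and f :: "complex^'n \<Rightarrow> complex"
  assumes open_\<Omega>: "open \<Omega>" and compact_K: "compact K" and K_sub: "K \<subseteq> \<Omega>"
    and f: "f holomorphic_Cn_on (\<Omega> - K)"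
    and R: "R > 0" and slice_R: "\<And>z. slice \<Omega> i z \<subseteq> square R"
begin

lemma open_\<Omega>K: "open (\<Omega> - K)"
  using open_\<Omega> compact_K by (simp add: compact_imp_closed open_Diff)

lemma compact_slice: "compact (slice K i z)"
proof -
  have "closed (subst_coord z i -` K)"
    by (rule closed_vimage[OF compact_imp_closed[OF compact_K]]) (intro continuous_intros)
  moreover have "subst_coord z i -` K = slice K i z"
    by (auto simp: slice_def)
  moreover have "slice K i z \<subseteq> square R"
    using slice_R[of z] K_sub by (auto simp: slice_def)
  then have "bounded (slice K i z)"
    using bounded_subset bounded_box by blast
  ultimately show ?thesis
    by (simp add: compact_eq_bounded_closed)
qed

lemma cutoff_slice_exists:
  assumes "z \<in> \<Omega>"
  shows "\<exists>\<phi>. cutoff (insert (z $ i) (slice K i z)) (slice \<Omega> i z) \<phi>"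
proof (rule cutoff_exists)
  show "compact (insert (z $ i) (slice K i z))"
    using compact_slice by (simp add: compact_insert)
  show "open (slice \<Omega> i z)"
    by (rule open_slice[OF open_\<Omega>])
  show "insert (z $ i) (slice K i z) \<subseteq> slice \<Omega> i z"
    using assms K_sub by (auto simp: slice_def)
qed

text \<open>The difference of two cutoff functions has compact support in the part of the slice where the
  integrand is holomorphic, so \<open>stokes\<close> applies.\<close>

lemma hartogs_integral_cutoff_indep:
  assumes "cutoff (insert (z $ i) (slice K i z)) (slice \<Omega> i z) \<phi>"
    and "cutoff (insert (z $ i) (slice K i z)) (slice \<Omega> i z) \<psi>"
  shows "hartogs_integral R i f \<phi> z = hartogs_integral R i f \<psi> z"
proof -
  let ?A = "insert (z $ i) (slice K i z)"
  obtain V L where 1: "open V" "?A \<subseteq> V" "\<And>w. w \<in> V \<Longrightarrow> \<phi> w = 1" "compact L" "L \<subseteq> slice \<Omega> i z"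
      "\<And>w. w \<notin> L \<Longrightarrow> \<phi> w = 0" and \<phi>: "C1_on UNIV \<phi>"
    using assms(1) unfolding cutoff_def by auto
  obtain V' L' where 2: "open V'" "?A \<subseteq> V'" "\<And>w. w \<in> V' \<Longrightarrow> \<psi> w = 1" "compact L'" "L' \<subseteq> slice \<Omega> i z"
      "\<And>w. w \<notin> L' \<Longrightarrow> \<psi> w = 0" and \<psi>: "C1_on UNIV \<psi>"
    using assms(2) unfolding cutoff_def by auto
  define U where "U = slice (\<Omega> - K) i z - {z $ i}"
  define h where "h = (\<lambda>w. f (subst_coord z i w) / (w - z $ i))"
  have U: "open U"
    unfolding U_def by (intro open_Diff open_slice open_\<Omega>K closed_singleton)
  have "(\<lambda>w. f (subst_coord z i w)) holomorphic_on U"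
    by (rule holomorphic_on_subset[OF holomorphic_Cn_on_slice[OF f]]) (auto simp: U_def slice_def)
  then have h: "h holomorphic_on U"
    unfolding h_def by (intro holomorphic_on_divide holomorphic_intros) (auto simp: U_def)
  have sub: "B - W \<subseteq> U" if "B \<subseteq> slice \<Omega> i z" "?A \<subseteq> W" for B W
    using that by (auto simp: U_def slice_def)
  have c: "continuous_on UNIV (\<lambda>w. dbar \<theta> w * h w)"
    if "C1_on UNIV \<theta>" "open W" "?A \<subseteq> W" "\<And>w. w \<in> W \<Longrightarrow> \<theta> w = 1" "compact B"
      "B \<subseteq> slice \<Omega> i z" "\<And>w. w \<notin> B \<Longrightarrow> \<theta> w = 0" for \<theta> W B
  proof (rule continuous_on_mult_supported[OF open_UNIV U, of "B - W"])
    show "closed (B - W)"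
      using that by (simp add: closed_Diff compact_imp_closed)
    show "dbar \<theta> w = 0" if "w \<in> UNIV - (B - W)" for w
      using dbar_supported[of W \<theta> B w] \<open>open W\<close> \<open>compact B\<close> \<open>\<And>w. w \<in> W \<Longrightarrow> \<theta> w = 1\<close>
        \<open>\<And>w. w \<notin> B \<Longrightarrow> \<theta> w = 0\<close> that by (auto intro: compact_imp_closed)
    show "continuous_on U h"
      by (rule holomorphic_on_imp_continuous_on[OF h])
    show "UNIV \<inter> (B - W) \<subseteq> U"
      using sub that by auto
  qed (use continuous_on_dbar that in auto)
  have "area_integral R (\<lambda>w. dbar (\<lambda>w. \<phi> w - \<psi> w) w * h w) = 0"
  proof (rule stokes[OF C1_on_diff[OF \<phi> \<psi>], of "(L \<union> L') - (V \<inter> V')" U])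
    show "closed ((L \<union> L') - (V \<inter> V'))"
      using 1 2 by (intro closed_Diff closed_Un compact_imp_closed) auto
    show "(L \<union> L') - (V \<inter> V') \<subseteq> U"
      using sub[of "L \<union> L'" "V \<inter> V'"] 1 2 by auto
    show "(L \<union> L') - (V \<inter> V') \<subseteq> square R"
      using slice_R[of z] 1 2 by auto
    show "\<phi> w - \<psi> w = 0" if "w \<notin> (L \<union> L') - (V \<inter> V')" for w
      using that 1(3,6) 2(3,6) by auto
  qed (use U h R in auto)
  also have "(\<lambda>w. dbar (\<lambda>w. \<phi> w - \<psi> w) w * h w) = (\<lambda>w. dbar \<phi> w * h w - dbar \<psi> w * h w)"
    using dbar_diff[OF \<phi> \<psi>] by (simp add: left_diff_distrib)
  finally have "area_integral R (\<lambda>w. dbar \<phi> w * h w) = area_integral R (\<lambda>w. dbar \<psi> w * h w)"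
    using area_integral_diff[OF c[OF \<phi> 1] c[OF \<psi> 2], of R] by simp
  then show ?thesis
    by (simp add: hartogs_integral_def h_def)
qed

lemma hartogs_extension_eq:
  assumes "cutoff (insert (z $ i) (slice K i z)) (slice \<Omega> i z) \<phi>"
  shows "hartogs_extension \<Omega> K R i f z = hartogs_integral R i f \<phi> z"
  unfolding hartogs_extension_def
proof (rule hartogs_integral_cutoff_indep[OF _ assms])
  show "cutoff (insert (z $ i) (slice K i z)) (slice \<Omega> i z)
      (SOME \<phi>. cutoff (insert (z $ i) (slice K i z)) (slice \<Omega> i z) \<phi>)"
    using assms by (rule someI[where P = "cutoff (insert (z $ i) (slice K i z)) (slice \<Omega> i z)"])
qed

text \<open>For a fixed cutoff function that is admissible at all points of \<open>N\<close>, the points \<open>w\<close> with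
  \<open>dbar \<phi> w \<noteq> 0\<close> lie in \<open>L - V\<close>, where the integrand is regular for every \<open>z \<in> N\<close>.\<close>

lemma hartogs_integral_holomorphic:
  assumes N: "open N" and \<phi>: "C1_on UNIV \<phi>"
    and V: "open V" "\<And>w. w \<in> V \<Longrightarrow> \<phi> w = 1"
    and L: "compact L" "\<And>w. w \<notin> L \<Longrightarrow> \<phi> w = 0"
    and NV: "\<And>z. z \<in> N \<Longrightarrow> insert (z $ i) (slice K i z) \<subseteq> V"
    and NL: "\<And>z. z \<in> N \<Longrightarrow> L \<subseteq> slice \<Omega> i z"
  shows "hartogs_integral R i f \<phi> holomorphic_Cn_on N"
proof -
  define M where "M = (\<lambda>z w. dbar \<phi> w * (f (subst_coord z i w) / (w - z $ i)))"
  have d0: "dbar \<phi> w = 0" if "w \<notin> L - V" for w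
    by (rule dbar_supported[OF V _ L(2) that]) (use L compact_imp_closed in auto)
  have reg: "subst_coord z i w \<in> \<Omega> - K" "w \<noteq> z $ i" if "z \<in> N" "w \<in> L - V" for z w
    using NV[OF that(1)] NL[OF that(1)] that(2) by (auto simp: slice_def)
  define U where "U = (\<lambda>x. subst_coord (fst x) i (snd x)) -` (\<Omega> - K) \<inter> {x. snd x - fst x $ i \<noteq> 0}"
  have cM: "continuous_on (N \<times> UNIV) (\<lambda>x. M (fst x) (snd x))"
    unfolding M_def
  proof (rule continuous_on_mult_supported[of _ U "UNIV \<times> (L - V)"])
    show "open (N \<times> (UNIV :: complex set))"
      using N by (intro open_Times) auto
    have "open ((\<lambda>x::(complex^'n) \<times> complex. subst_coord (fst x) i (snd x)) -` (\<Omega> - K))"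
      by (rule open_vimage[OF open_\<Omega>K]) (intro continuous_intros)
    moreover have "open {x::(complex^'n) \<times> complex. snd x - fst x $ i \<noteq> 0}"
      by (rule open_Collect_neq) (intro continuous_intros)+
    ultimately show "open U"
      unfolding U_def by (rule open_Int)
    show "closed (UNIV \<times> (L - V))"
      using L V by (intro closed_Times closed_Diff compact_imp_closed) auto
    show "continuous_on (N \<times> UNIV) (\<lambda>x. dbar \<phi> (snd x))"
      by (rule continuous_on_compose2[OF continuous_on_dbar[OF \<phi>]]) (auto intro: continuous_intros)
    have cf: "continuous_on (\<Omega> - K) f"
      using f by (simp add: holomorphic_Cn_on_def)
    show "continuous_on U (\<lambda>x. f (subst_coord (fst x) i (snd x)) / (snd x - fst x $ i))"
    proof (rule continuous_on_divide)
      show "continuous_on U (\<lambda>x. f (subst_coord (fst x) i (snd x)))"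
        by (rule continuous_on_compose2[OF cf], intro continuous_intros) (auto simp: U_def)
      show "continuous_on U (\<lambda>x. snd x - fst x $ i)"
        by (intro continuous_intros)
    qed (simp add: U_def)
    show "N \<times> UNIV \<inter> UNIV \<times> (L - V) \<subseteq> U"
      using reg by (force simp: U_def)
    show "dbar \<phi> (snd x) = 0" if "x \<in> N \<times> UNIV - UNIV \<times> (L - V)" for x
      using d0[of "snd x"] that by (cases x) auto
  qed
  have cM_compose: "continuous_on S (\<lambda>x. M (a x) (b x))"
    if "continuous_on S a" "continuous_on S b" "\<And>x. x \<in> S \<Longrightarrow> a x \<in> N"
    for S :: "'b::topological_space set" and a b
    using continuous_on_compose2[OF cM continuous_on_Pair[OF that(1,2)]] that(3) by auto
  have H: "hartogs_integral R i f \<phi> z =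
      - integral (cbox (- R, - R) (R, R)) (\<lambda>p. M z (Complex (fst p) (snd p))) / (2 * pi)" for z
    by (simp add: hartogs_integral_def area_integral_def M_def case_prod_unfold)
  show ?thesis
    unfolding holomorphic_Cn_on_def
  proof (intro conjI ballI allI)
    have "continuous_on (N \<times> cbox (- R, - R) (R, R)) (\<lambda>x. M (fst x) (Complex (fst (snd x)) (snd (snd x))))"
      by (rule cM_compose) (auto intro!: continuous_intros)
    then have "continuous_on N (\<lambda>z. integral (cbox (- R, - R) (R, R)) (\<lambda>p. M z (Complex (fst p) (snd p))))"
      by (intro integral_continuous_on_param) (simp add: case_prod_unfold)
    then show "continuous_on N (hartogs_integral R i f \<phi>)"
      unfolding H[abs_def] by (intro continuous_intros) auto
  next
    fix z m
    define T where "T = {t. subst_coord z m t \<in> N}"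
    have T: "open T"
      unfolding T_def by (rule open_Collect_subst_coord[OF N])
    have "(\<lambda>t. integral (cbox (- R, - R) (R, R)) (\<lambda>p. M (subst_coord z m t) (Complex (fst p) (snd p)))) holomorphic_on T"
    proof (rule holomorphic_parameter_integral[OF T])
      have "continuous_on (T \<times> cbox (- R, - R) (R, R)) (\<lambda>x. M (subst_coord z m (fst x)) (Complex (fst (snd x)) (snd (snd x))))"
        by (rule cM_compose) (auto intro!: continuous_intros simp: T_def)
      then show "continuous_on (T \<times> cbox (- R, - R) (R, R)) (\<lambda>(t, p). M (subst_coord z m t) (Complex (fst p) (snd p)))"
        by (simp add: case_prod_unfold)
    next
      fix p :: "real \<times> real"
      define w where "w = Complex (fst p) (snd p)"
      have "(\<lambda>t. M (subst_coord z m t) w) holomorphic_on T"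
      proof (cases "w \<in> L - V")
        case False
        then show ?thesis by (simp add: M_def d0)
      next
        case True
        have r: "subst_coord (subst_coord z m t) i w \<in> \<Omega> - K" "w \<noteq> subst_coord z m t $ i"
          if "t \<in> T" for t
          using reg[OF _ True] that unfolding T_def by blast+
        have "(\<lambda>t. f (subst_coord (subst_coord z m t) i w)) holomorphic_on T"
        proof (cases "m = i")
          case True
          then show ?thesis by simp
        next
          case False
          have "(\<lambda>t. f (subst_coord (subst_coord z i w) m t)) holomorphic_on T"
            by (rule holomorphic_on_subset[OF holomorphic_Cn_on_slice[OF f]])
              (use r(1) subst_coord_swap[OF False] in auto)
          then show ?thesis by (simp add: subst_coord_swap[OF False])
        qed
        moreover have "(\<lambda>t. subst_coord z m t $ i) holomorphic_on T"
          by (cases "i = m") (auto intro: holomorphic_intros)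
        ultimately show ?thesis
          unfolding M_def using r(2)
          by (intro holomorphic_on_mult holomorphic_on_divide holomorphic_on_diff holomorphic_on_const) auto
      qed
      then show "(\<lambda>t. M (subst_coord z m t) (Complex (fst p) (snd p))) holomorphic_on T"
        by (simp add: w_def)
    qed
    then show "(\<lambda>t. hartogs_integral R i f \<phi> (subst_coord z m t)) holomorphic_on {t. subst_coord z m t \<in> N}"
      unfolding H T_def[symmetric] by (intro holomorphic_intros) auto
  qed
qed

text \<open>A cutoff function that is admissible at \<open>z0\<close> remains admissible at all nearby points, and there
  the extension is the integral with this fixed cutoff function.\<close>

lemma hartogs_extension_holomorphic: "hartogs_extension \<Omega> K R i f holomorphic_Cn_on \<Omega>"
proof (rule holomorphic_Cn_on_local)
  fix z0 assume z0: "z0 \<in> \<Omega>"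
  obtain \<phi> where \<phi>: "cutoff (insert (z0 $ i) (slice K i z0)) (slice \<Omega> i z0) \<phi>"
    using cutoff_slice_exists[OF z0] by blast
  then obtain V L where V: "open V" "insert (z0 $ i) (slice K i z0) \<subseteq> V" "\<And>w. w \<in> V \<Longrightarrow> \<phi> w = 1"
    and L: "compact L" "L \<subseteq> slice \<Omega> i z0" "\<And>w. w \<notin> L \<Longrightarrow> \<phi> w = 0" and C: "C1_on UNIV \<phi>"
    unfolding cutoff_def by auto
  obtain N1 where N1: "open N1" "z0 \<in> N1" "\<And>z. z \<in> N1 \<Longrightarrow> L \<subseteq> slice \<Omega> i z"
    by (rule slice_tube[OF L(1) open_\<Omega> L(2)]) blast
  \<comment> \<open>Slices of \<open>K\<close> stay inside \<open>V\<close> because they avoid the compact set \<open>?C\<close>, the rest of the square.\<close>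
  let ?C = "closure (square R) - V"
  have C1: "compact ?C"
    using V(1) by (intro compact_diff) (auto simp: compact_closure)
  have C2: "open (- K)"
    by (rule open_Compl[OF compact_imp_closed[OF compact_K]])
  have C3: "?C \<subseteq> slice (- K) i z0"
    using V(2) by (auto simp: slice_def)
  obtain N2 where N2: "open N2" "z0 \<in> N2" "\<And>z. z \<in> N2 \<Longrightarrow> ?C \<subseteq> slice (- K) i z"
    by (rule slice_tube[OF C1 C2 C3]) blast
  define N where "N = N1 \<inter> N2 \<inter> (\<lambda>z. z $ i) -` V"
  have "open ((\<lambda>z::complex^'n. z $ i) -` V)"
    by (rule open_vimage[OF V(1)]) (intro continuous_intros)
  then have N: "open N" "z0 \<in> N"
    using N1 N2 V by (auto simp: N_def)
  have NV: "insert (z $ i) (slice K i z) \<subseteq> V" if "z \<in> N" for z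
  proof -
    have "slice K i z \<subseteq> closure (square R)"
      using slice_R[of z] K_sub closure_subset[of "square R"] by (force simp: slice_def)
    moreover have "?C \<subseteq> slice (- K) i z"
      using N2(3) that by (simp add: N_def)
    ultimately show ?thesis
      using that by (auto simp: N_def slice_def)
  qed
  have NL: "L \<subseteq> slice \<Omega> i z" if "z \<in> N" for z
    using N1(3) that by (simp add: N_def)
  have "hartogs_integral R i f \<phi> z = hartogs_extension \<Omega> K R i f z" if "z \<in> N" for z
  proof (rule hartogs_extension_eq[symmetric])
    show "cutoff (insert (z $ i) (slice K i z)) (slice \<Omega> i z) \<phi>"
      unfolding cutoff_def using C V(1,3) L(1,3) NV[OF that] NL[OF that] by blast
  qed
  then have "hartogs_extension \<Omega> K R i f holomorphic_Cn_on N"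
    using hartogs_integral_holomorphic[OF N(1) C V(1,3) L(1,3) NV NL] by (rule holomorphic_Cn_on_cong)
  then show "\<exists>N. open N \<and> z0 \<in> N \<and> hartogs_extension \<Omega> K R i f holomorphic_Cn_on N"
    using N by blast
qed

text \<open>Where the slice misses \<open>K\<close>, this is Cauchy's integral formula.\<close>

lemma hartogs_extension_eq_f:
  assumes z: "z \<in> \<Omega>" and empty: "slice K i z = {}"
  shows "hartogs_extension \<Omega> K R i f z = f z"
proof -
  obtain \<phi> where \<phi>: "cutoff (insert (z $ i) (slice K i z)) (slice \<Omega> i z) \<phi>"
    using cutoff_slice_exists[OF z] by blast
  then obtain V L where V: "open V" "z $ i \<in> V" "\<And>w. w \<in> V \<Longrightarrow> \<phi> w = 1"
    and L: "compact L" "L \<subseteq> slice \<Omega> i z" "\<And>w. w \<notin> L \<Longrightarrow> \<phi> w = 0" and C: "C1_on UNIV \<phi>"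
    unfolding cutoff_def by auto
  have "slice \<Omega> i z \<subseteq> {w. subst_coord z i w \<in> \<Omega> - K}"
    using empty by (auto simp: slice_def)
  then have h: "(\<lambda>w. f (subst_coord z i w)) holomorphic_on slice \<Omega> i z"
    using holomorphic_on_subset[OF holomorphic_Cn_on_slice[OF f]] by blast
  have "area_integral R (\<lambda>w. dbar \<phi> w * (f (subst_coord z i w) / (w - z $ i))) = - 2 * pi * f z"
    using cauchy_pompeiu_cutoff[OF C compact_imp_closed[OF L(1)] _ L(2,3) V R open_slice[OF open_\<Omega>] h]
      L(2) slice_R[of z] by simp
  then show ?thesis
    by (simp add: hartogs_extension_eq[OF \<phi>] hartogs_integral_def)
qed

end

section \<open>The Hartogs extension theorem\<close>

text \<open>This is where a second coordinate is needed: beyond the maximum of \<open>Re (z $ j)\<close> on \<open>K\<close>, no line in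
  the direction of coordinate \<open>i\<close> meets \<open>K\<close>, and \<open>\<Omega>\<close> reaches beyond that maximum because it is open.
  If \<open>K\<close> is empty, all of \<open>\<Omega>\<close> will do.\<close>

lemma exists_open_missing_slices:
  fixes \<Omega> K :: "(complex^'n) set"
  assumes ij: "i \<noteq> j" and \<Omega>: "open \<Omega>" "\<Omega> \<noteq> {}" and K: "compact K" "K \<subseteq> \<Omega>"
  obtains W where "open W" "W \<noteq> {}" "W \<subseteq> \<Omega> - K" "\<And>z. z \<in> W \<Longrightarrow> slice K i z = {}"
proof (cases "K = {}")
  case True
  then show thesis using \<Omega> by (intro that[of \<Omega>]) (auto simp: slice_def)
next
  case False
  have "continuous_on K (\<lambda>z. Re (z $ j))"
    by (intro continuous_intros)
  then obtain p where p: "p \<in> K" "\<And>z. z \<in> K \<Longrightarrow> Re (z $ j) \<le> Re (p $ j)"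
    using continuous_attains_sup[OF K(1) False] by blast
  define W where "W = \<Omega> \<inter> {z. Re (z $ j) > Re (p $ j)}"
  have "open {z::complex^'n. Re (z $ j) > Re (p $ j)}"
    by (intro open_Collect_less continuous_intros)
  then have "open W"
    using \<Omega> unfolding W_def by blast
  moreover have "W \<noteq> {}"
  proof -
    have "p $ j \<in> slice \<Omega> j p"
      using p K by (auto simp: slice_def)
    then obtain e where e: "e > 0" "ball (p $ j) e \<subseteq> slice \<Omega> j p"
      using open_slice[OF \<Omega>(1)] openE by blast
    then have "p $ j + of_real (e/2) \<in> slice \<Omega> j p"
      by (auto simp: dist_norm)
    then have "subst_coord p j (p $ j + of_real (e/2)) \<in> W"
      using e(1) by (simp add: W_def slice_def)
    then show ?thesis by blast
  qed
  moreover have "slice K i z = {}" if "z \<in> W" for z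
  proof -
    have "False" if "w \<in> slice K i z" for w
      using p(2)[of "subst_coord z i w"] that \<open>z \<in> W\<close> ij by (auto simp: W_def slice_def)
    then show ?thesis by blast
  qed
  moreover have "W \<subseteq> \<Omega> - K"
    using p(2) by (force simp: W_def)
  ultimately show thesis using that by blast
qed

theorem theorem1:
  fixes \<Omega> K :: "(complex ^ 'n) set" and f :: "complex ^ 'n \<Rightarrow> complex"
  assumes "CARD('n) \<ge> 2"
    and "domain_Cn \<Omega>" and "bounded \<Omega>"
    and "compact K" and "K \<subseteq> \<Omega>"
    and "domain_Cn (\<Omega> - K)"
    and "f holomorphic_Cn_on (\<Omega> - K)"
  shows "\<exists>!g. g \<in> extensional \<Omega> \<and> g holomorphic_Cn_on \<Omega> \<and> (\<forall>z\<in>\<Omega> - K. g z = f z)"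
proof -
  have \<Omega>: "open \<Omega>" "connected \<Omega>" and \<Omega>K: "open (\<Omega> - K)" "connected (\<Omega> - K)"
    using assms(2,6) by (auto simp: domain_Cn_def path_connected_imp_connected)
  obtain i j :: 'n where ij: "i \<noteq> j"
    using card_le_Suc0_iff_eq[of "UNIV :: 'n set"] assms(1) by auto
  obtain R where R: "R > 0" "\<And>z. z \<in> \<Omega> \<Longrightarrow> norm z < R"
    using assms(3) by (meson bounded_pos_less)
  have "slice \<Omega> i z \<subseteq> square R" for z
  proof
    fix w assume "w \<in> slice \<Omega> i z"
    then have "norm (subst_coord z i w) < R"
      using R(2) by (simp add: slice_def)
    moreover have "norm w \<le> norm (subst_coord z i w)"
      using Finite_Cartesian_Product.norm_nth_le[of "subst_coord z i w" i] by simp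
    ultimately have "norm w < R" by simp
    then show "w \<in> square R"
      using abs_Re_le_cmod[of w] abs_Im_le_cmod[of w] by (auto simp: in_box_complex_iff)
  qed
  then interpret hartogs_data \<Omega> K R i f
    using \<Omega> assms R by unfold_locales auto
  define F where "F = restrict (hartogs_extension \<Omega> K R i f) \<Omega>"
  have F: "F holomorphic_Cn_on \<Omega>"
    by (rule holomorphic_Cn_on_cong[OF _ hartogs_extension_holomorphic]) (simp add: F_def)
  have Ff: "F z = f z" if z: "z \<in> \<Omega> - K" for z
  proof -
    have "\<Omega> \<noteq> {}" using z by blast
    from exists_open_missing_slices[OF ij \<Omega>(1) this assms(4,5)]
    obtain W where W: "open W" "W \<noteq> {}" "W \<subseteq> \<Omega> - K" "\<And>z. z \<in> W \<Longrightarrow> slice K i z = {}" by blast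
    have "F z = f z" if "z \<in> W" for z
      using hartogs_extension_eq_f[of z] W(3,4) that by (auto simp: F_def)
    then show ?thesis
      using holomorphic_Cn_identity[OF \<Omega>K holomorphic_Cn_on_subset[OF F] assms(7) W(1-3) _ z] by blast
  qed
  show ?thesis
  proof (rule ex1I[of _ F])
    show "F \<in> extensional \<Omega> \<and> F holomorphic_Cn_on \<Omega> \<and> (\<forall>z\<in>\<Omega> - K. F z = f z)"
      using F Ff by (auto simp: F_def)
    fix g assume g: "g \<in> extensional \<Omega> \<and> g holomorphic_Cn_on \<Omega> \<and> (\<forall>z\<in>\<Omega> - K. g z = f z)"
    show "g = F"
    proof (rule extensionalityI)
      show "g \<in> extensional \<Omega>" "F \<in> extensional \<Omega>"
        using g by (auto simp: F_def)
      fix z assume z: "z \<in> \<Omega>"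
      then have "\<Omega> \<noteq> {}" by blast
      from exists_open_missing_slices[OF ij \<Omega>(1) this assms(4,5)]
      obtain W where W: "open W" "W \<noteq> {}" "W \<subseteq> \<Omega> - K" "\<And>z. z \<in> W \<Longrightarrow> slice K i z = {}" by blast
      show "g z = F z"
        by (rule holomorphic_Cn_identity[OF \<Omega> _ F W(1,2) _ _ z]) (use g W(3) Ff in auto)
    qed
  qed
qed

end
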